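(* Let $o_n$ be the number of isomorphism classes of $n$-element graded posets that avoid both $(2+2)$ and $(3+1)$ (with $o_0=1$ for the empty poset). Then \[\sum_{n\ge 0} o_n x^n=\frac{1-3x+2x^2-x^3}{(1-x)(1-3x+x^2)}.\]
   Context: A finite poset is graded if all its maximal chains have the same number of elements. A poset contains $(a+b)$ if it has disjoint chains of $a$ and $b$ elements such that every element of one is incomparable with every element of the other; otherwise it avoids $(a+b)$. Graded posets avoiding both $(2+2)$ and $(3+1)$ are called graded semiorders. *)

theory Defs
  imports "HOL-Computational_Algebra.Formal_Power_Series"
begin

text \<open>A poset is a carrier \<open>A\<close> with a relation \<open>r \<subseteq> A \<times> A\<close> (the non-strict order) such that
  \<^term>\<open>partial_order_on A r\<close>.\<close>

abbreviation poset_chain :: "'a set \<Rightarrow> 'a rel \<Rightarrow> 'a set \<Rightarrow> bool" where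
  "poset_chain A r \<equiv> pred_on.chain A (\<lambda>x y. (x, y) \<in> r)"

abbreviation poset_maxchain :: "'a set \<Rightarrow> 'a rel \<Rightarrow> 'a set \<Rightarrow> bool" where
  "poset_maxchain A r \<equiv> pred_on.maxchain A (\<lambda>x y. (x, y) \<in> r)"

text \<open>Only meaningful for finite \<open>A\<close>, where \<^term>\<open>card\<close> is the number of elements.\<close>

definition graded_poset :: "'a set \<Rightarrow> 'a rel \<Rightarrow> bool" where
  "graded_poset A r \<longleftrightarrow>
     (\<forall>C D. poset_maxchain A r C \<longrightarrow> poset_maxchain A r D \<longrightarrow> card C = card D)"

definition contains_chain_sum :: "nat \<Rightarrow> nat \<Rightarrow> 'a set \<Rightarrow> 'a rel \<Rightarrow> bool" where
  "contains_chain_sum a b A r \<longleftrightarrow>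
     (\<exists>C D. poset_chain A r C \<and> poset_chain A r D \<and> finite C \<and> finite D \<and>
        card C = a \<and> card D = b \<and> C \<inter> D = {} \<and>
        (\<forall>x\<in>C. \<forall>y\<in>D. (x, y) \<notin> r \<and> (y, x) \<notin> r))"

definition graded_semiorder_on :: "'a set \<Rightarrow> 'a rel \<Rightarrow> bool" where
  "graded_semiorder_on A r \<longleftrightarrow> finite A \<and> partial_order_on A r \<and> graded_poset A r \<and>
     \<not> contains_chain_sum 2 2 A r \<and> \<not> contains_chain_sum 3 1 A r"

definition poset_isomorphic :: "'a set \<Rightarrow> 'a rel \<Rightarrow> 'b set \<Rightarrow> 'b rel \<Rightarrow> bool" where
  "poset_isomorphic A r B s \<longleftrightarrow>
     (\<exists>f. bij_betw f A B \<and> (\<forall>x\<in>A. \<forall>y\<in>A. (x, y) \<in> r \<longleftrightarrow> (f x, f y) \<in> s))"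

text \<open>Every \<open>n\<close>-element poset is isomorphic to one with carrier \<open>{..<n}\<close>, so the isomorphism
  classes of \<open>n\<close>-element graded semiorders are counted on that carrier.\<close>

definition graded_semiorders :: "nat \<Rightarrow> nat rel set" where
  "graded_semiorders n = {r. graded_semiorder_on {..<n} r}"

definition graded_semiorder_iso :: "nat \<Rightarrow> (nat rel) rel" where
  "graded_semiorder_iso n =
     {(r, s). r \<in> graded_semiorders n \<and> s \<in> graded_semiorders n \<and>
        poset_isomorphic {..<n} r {..<n} s}"

lemma equiv_graded_semiorder_iso: "equiv (graded_semiorders n) (graded_semiorder_iso n)"
proof (rule equivI)
  show "graded_semiorder_iso n \<subseteq> graded_semiorders n \<times> graded_semiorders n"
    by (auto simp: graded_semiorder_iso_def)
  have "bij_betw id {..<n} {..<n}"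
    by simp
  then show "refl_on (graded_semiorders n) (graded_semiorder_iso n)"
    unfolding refl_on_def graded_semiorder_iso_def poset_isomorphic_def by fastforce
  show "sym (graded_semiorder_iso n)"
  proof (rule symI)
    fix r s
    assume rs: "(r, s) \<in> graded_semiorder_iso n"
    then obtain f where f: "bij_betw f {..<n} {..<n}"
      and iso: "\<forall>x\<in>{..<n}. \<forall>y\<in>{..<n}. (x, y) \<in> r \<longleftrightarrow> (f x, f y) \<in> s"
      unfolding graded_semiorder_iso_def poset_isomorphic_def by blast
    let ?g = "inv_into {..<n} f"
    have g: "bij_betw ?g {..<n} {..<n}"
      using f by (rule bij_betw_inv_into)
    have "(x, y) \<in> s \<longleftrightarrow> (?g x, ?g y) \<in> r" if "x \<in> {..<n}" "y \<in> {..<n}" for x y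
      using iso that bij_betwE[OF g] bij_betw_inv_into_right[OF f] by simp
    with g rs show "(s, r) \<in> graded_semiorder_iso n"
      unfolding graded_semiorder_iso_def poset_isomorphic_def by blast
  qed
  show "trans (graded_semiorder_iso n)"
  proof (rule transI)
    fix r s t
    assume rs: "(r, s) \<in> graded_semiorder_iso n" and st: "(s, t) \<in> graded_semiorder_iso n"
    from rs obtain f where f: "bij_betw f {..<n} {..<n}"
      and iso_f: "\<forall>x\<in>{..<n}. \<forall>y\<in>{..<n}. (x, y) \<in> r \<longleftrightarrow> (f x, f y) \<in> s"
      unfolding graded_semiorder_iso_def poset_isomorphic_def by blast
    from st obtain g where g: "bij_betw g {..<n} {..<n}"
      and iso_g: "\<forall>x\<in>{..<n}. \<forall>y\<in>{..<n}. (x, y) \<in> s \<longleftrightarrow> (g x, g y) \<in> t"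
      unfolding graded_semiorder_iso_def poset_isomorphic_def by blast
    have "bij_betw (g \<circ> f) {..<n} {..<n}"
      using f g by (rule bij_betw_trans)
    moreover have "(x, y) \<in> r \<longleftrightarrow> ((g \<circ> f) x, (g \<circ> f) y) \<in> t"
      if "x \<in> {..<n}" "y \<in> {..<n}" for x y
      using iso_f iso_g that bij_betwE[OF f] by simp
    ultimately show "(r, t) \<in> graded_semiorder_iso n"
      using rs st unfolding graded_semiorder_iso_def poset_isomorphic_def by blast
  qed
qed

definition num_graded_semiorders :: "nat \<Rightarrow> nat" where
  "num_graded_semiorders n = card (graded_semiorders n // graded_semiorder_iso n)"

end

theory Submission
  imports Defs "HOL-Library.Multiset"
begin

text \<open>Sorting the elements of a semiorder by the number of elements below minus the number of
  elements above makes every strict up-set a final segment, so the semiorder is encoded up to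
  isomorphism by a unique monotone function \<open>f\<close> with \<open>x < y\<close> in the poset iff \<open>f x \<le> y\<close>. The orbit
  \<open>0, f 0, f (f 0), \<dots>\<close> cuts the positions into antichain levels, and the poset is graded iff
  every maximal chain meets every level, which comes down to \<open>f (f (b - 1)) = f b\<close> for all
  orbit points \<open>b > 0\<close>. Every code satisfying this condition arises from a smaller one by one of
  five insertions near the bottom. With \<open>o n\<close> counting these codes for \<open>n\<close> elements, and \<open>h n\<close>
  those with \<open>2 \<le> f 0 < f 1\<close>, this gives \<open>o (n + 1) = 2 o n + h (n + 1)\<close> and
  \<open>h (n + 3) = o n + 2 h (n + 2)\<close> for \<open>n > 0\<close>, hence the generating function.\<close>

section \<open>Codes and their recursive structure\<close>

text \<open>Beyond the \<open>n\<close> positions of the poset a code continues with an infinite chain, so that no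
  bound on \<open>f\<close> has to be checked separately; for \<open>n > 0\<close> the conditions force \<open>f (n - 1) = n\<close>.\<close>

definition semiorder_code :: "nat \<Rightarrow> (nat \<Rightarrow> nat) \<Rightarrow> bool" where
  "semiorder_code n f \<longleftrightarrow> mono f \<and> (\<forall>x. x < f x) \<and> (\<forall>x. n \<le> Suc x \<longrightarrow> f x = Suc x)"

text \<open>Only used for \<open>a > 0\<close>; the whole orbit of \<open>a\<close> is then positive, so \<open>- 1\<close> does not truncate.\<close>

definition graded_from :: "(nat \<Rightarrow> nat) \<Rightarrow> nat \<Rightarrow> bool" where
  "graded_from f a \<longleftrightarrow> (\<forall>j. f (f ((f ^^ j) a - 1)) = f ((f ^^ j) a))"

definition codes :: "nat \<Rightarrow> (nat \<Rightarrow> nat) set" where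
  "codes n = {f. semiorder_code n f \<and> graded_from f (f 0)}"

text \<open>These are the codes that remain once a bottom element (\<open>f 0 = 1\<close>) and twin
  minimal elements 0 and 1 (\<open>f 0 = f 1\<close>) are excluded.\<close>

definition split_codes :: "nat \<Rightarrow> (nat \<Rightarrow> nat) set" where
  "split_codes n = {f \<in> codes n. 2 \<le> f 0 \<and> f 0 < f 1}"

text \<open>The orbit of \<open>a\<close> is \<open>a\<close> followed by the orbit of
  \<open>f a\<close>. Peeling off first points reduces the comparison of two codes to a region where
  one is a shift of the other.\<close>

lemma graded_from_unfold:
  "graded_from f a \<longleftrightarrow> f (f (a - 1)) = f a \<and> graded_from f (f a)"
proof -
  have "(\<forall>j. P j) \<longleftrightarrow> P 0 \<and> (\<forall>j. P (Suc j))" for P :: "nat \<Rightarrow> bool"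
    by (metis not0_implies_Suc)
  from this[of "\<lambda>j. f (f ((f ^^ j) a - 1)) = f ((f ^^ j) a)"] show ?thesis
    unfolding graded_from_def by (simp add: funpow_swap1)
qed

lemma le_funpow:
  fixes g :: "nat \<Rightarrow> nat"
  assumes "\<And>x. x < g x"
  shows "a \<le> (g ^^ j) a"
  by (induction j) (use assms in \<open>auto intro: le_trans less_imp_le\<close>)

text \<open>The orbit of \<open>a + k\<close> under \<open>f\<close> is the orbit of
  \<open>a\<close> under \<open>g\<close>, moved by \<open>k\<close>. Strictness in
  \<open>c < a\<close> matters because the condition at an orbit point \<open>b\<close> also
  evaluates at \<open>b - 1\<close>, which must still be at least \<open>c\<close>.\<close>

lemma graded_from_shift:
  fixes f g :: "nat \<Rightarrow> nat"
  assumes shift: "\<And>y. c \<le> y \<Longrightarrow> f (y + k) = g y + k" and "c < a" and g: "\<And>x. x < g x"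
  shows "graded_from f (a + k) \<longleftrightarrow> graded_from g a"
proof -
  have a: "a \<le> (g ^^ j) a" for j
    using g by (rule le_funpow)
  have orbit: "(f ^^ j) (a + k) = (g ^^ j) a + k" for j
  proof (induction j)
    case (Suc j)
    then show ?case using shift[of "(g ^^ j) a"] a[of j] \<open>c < a\<close> by simp
  qed simp
  have "f (f ((f ^^ j) (a + k) - 1)) = f ((f ^^ j) (a + k)) \<longleftrightarrow> g (g ((g ^^ j) a - 1)) = g ((g ^^ j) a)" for j
  proof -
    let ?b = "(g ^^ j) a"
    have b: "c \<le> ?b - 1" "c \<le> ?b" "?b + k - 1 = ?b - 1 + k"
      using a[of j] \<open>c < a\<close> by linarith+
    moreover have "c \<le> g (?b - 1)"
      using g[of "?b - 1"] b by linarith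
    ultimately show ?thesis
      unfolding orbit by (simp add: shift)
  qed
  then show ?thesis
    unfolding graded_from_def by simp
qed

text \<open>For \<open>a = g 0\<close> this duplicates a minimal element, and for \<open>a = 0\<close> it adds a new bottom element.\<close>

definition prepend_code :: "nat \<Rightarrow> (nat \<Rightarrow> nat) \<Rightarrow> nat \<Rightarrow> nat" where
  "prepend_code a g = case_nat (Suc a) (\<lambda>y. Suc (g y))"

text \<open>If \<open>2 \<le> f 0 < f 1\<close>, then element 0 is below the whole second level, element 1 is not, and the
  second level starts at \<open>f 0\<close> with an element that is not above the whole first level. If these
  elements 1 and \<open>f 0\<close> are the only incomplete ones between the two levels and 0, 1 make up the
  first level, then \<open>add_three\<close> created the code; otherwise \<open>add_lower\<close> inserted element 1 if
  \<open>f 1 = f 0 + 1\<close>, and \<open>add_upper\<close> inserted element \<open>f 0\<close> if \<open>f 1\<close> is larger.\<close>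

definition add_three :: "(nat \<Rightarrow> nat) \<Rightarrow> nat \<Rightarrow> nat" where
  "add_three g x = (if x = 0 then 2 else if x = 1 then 3 else if x = 2 then g 0 + 3 else g (x - 3) + 3)"

definition add_lower :: "(nat \<Rightarrow> nat) \<Rightarrow> nat \<Rightarrow> nat" where
  "add_lower g x = (if x = 0 then g 0 + 1 else if x = 1 then g 0 + 2 else g (x - 1) + 1)"

definition add_upper :: "(nat \<Rightarrow> nat) \<Rightarrow> nat \<Rightarrow> nat" where
  "add_upper g x = (if x = 0 then g 0 else if x \<le> g 0 then g x + 1 else g (x - 1) + 1)"

section \<open>The five insertions preserve and reflect being a code\<close>

text \<open>Directly or through the extra orbit point 1, the new orbit reaches
  \<open>Suc (g 0)\<close>, from where it is the orbit of \<open>g\<close> moved by one. The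
  condition at 1 is trivial, as the value at 0 is then 1.\<close>

lemma prepend_code_in_codes_iff:
  assumes "0 < n" "a = 0 \<or> a = g 0"
  shows "prepend_code a g \<in> codes (Suc n) \<longleftrightarrow> g \<in> codes n"
proof -
  let ?f = "prepend_code a g"
  have f: "?f 0 = Suc a" "?f (Suc y) = Suc (g y)" for y
    by (simp_all add: prepend_code_def)
  have "semiorder_code (Suc n) ?f \<longleftrightarrow> semiorder_code n g"
  proof
    assume "semiorder_code (Suc n) ?f"
    then have m: "mono ?f" and l: "\<And>x. x < ?f x" and t: "\<And>x. n \<le> x \<Longrightarrow> ?f x = Suc x"
      unfolding semiorder_code_def by auto
    have "g x \<le> g (Suc x)" for x
      using monoD[OF m, of "Suc x" "Suc (Suc x)"] by (simp add: f)
    moreover have "x < g x" for x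
      using l[of "Suc x"] by (simp add: f)
    moreover have "g x = Suc x" if "n \<le> Suc x" for x
      using t[OF that] by (simp add: f)
    ultimately show "semiorder_code n g"
      unfolding semiorder_code_def by (simp add: mono_iff_le_Suc)
  next
    assume "semiorder_code n g"
    then have m: "mono g" and l: "\<And>x. x < g x" and t: "\<And>x. n \<le> Suc x \<Longrightarrow> g x = Suc x"
      unfolding semiorder_code_def by auto
    have "?f x \<le> ?f (Suc x)" for x
      by (cases x) (use m assms in \<open>auto simp: f mono_iff_le_Suc\<close>)
    moreover have "x < ?f x" for x
      by (cases x) (use l in \<open>auto simp: f\<close>)
    moreover have "?f x = Suc x" if "Suc n \<le> Suc x" for x
      by (cases x) (use t that assms in \<open>auto simp: f\<close>)
    ultimately show "semiorder_code (Suc n) ?f"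
      unfolding semiorder_code_def by (simp add: mono_iff_le_Suc)
  qed
  moreover have "graded_from ?f (?f 0) \<longleftrightarrow> graded_from g (g 0)" if "semiorder_code n g"
  proof -
    have "graded_from ?f (Suc (g 0)) \<longleftrightarrow> graded_from g (g 0)"
      using that graded_from_shift[of 0 ?f 1 g "g 0"] unfolding semiorder_code_def by (simp add: f)
    then show ?thesis
      using assms(2) graded_from_unfold[of ?f 1] f(2)[of 0] by (auto simp: f(1))
  qed
  ultimately show ?thesis
    unfolding codes_def by auto
qed

text \<open>The new orbit starts with 2 and continues with \<open>g 0 + 3\<close>, the moved orbit
  of \<open>g\<close>. The condition at 2 asks for equal values at 2 and 3, and both are
  \<open>g 0 + 3\<close>.\<close>

lemma add_three_in_codes_iff:
  assumes "0 < n"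
  shows "add_three g \<in> codes (n + 3) \<longleftrightarrow> g \<in> codes n"
proof -
  let ?f = "add_three g"
  have f: "?f 0 = 2" "?f (Suc 0) = 3" "?f 2 = g 0 + 3" "?f (y + 3) = g y + 3" for y
    by (simp_all add: add_three_def)
  have "semiorder_code (n + 3) ?f \<longleftrightarrow> semiorder_code n g"
  proof
    assume "semiorder_code (n + 3) ?f"
    then have m: "mono ?f" and l: "\<And>x. x < ?f x" and t: "\<And>x. n + 3 \<le> Suc x \<Longrightarrow> ?f x = Suc x"
      unfolding semiorder_code_def by auto
    have "g x \<le> g (Suc x)" for x
      using monoD[OF m, of "x + 3" "Suc x + 3"] f(4)[of x] f(4)[of "Suc x"] by linarith
    moreover have "x < g x" for x
      using l[of "x + 3"] f(4)[of x] by linarith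
    moreover have "g x = Suc x" if "n \<le> Suc x" for x
      using t[of "x + 3"] f(4)[of x] that by linarith
    ultimately show "semiorder_code n g"
      unfolding semiorder_code_def by (simp add: mono_iff_le_Suc)
  next
    assume "semiorder_code n g"
    then have m: "mono g" and l: "\<And>x. x < g x" and t: "\<And>x. n \<le> Suc x \<Longrightarrow> g x = Suc x"
      unfolding semiorder_code_def by auto
    have x: "x = 0 \<or> x = 1 \<or> x = 2 \<or> (\<exists>y. x = y + 3)" for x :: nat
      by presburger
    have "?f x \<le> ?f (Suc x)" for x
      using x[of x] monoD[OF m, of "x - 3" "Suc x - 3"] by (auto simp: add_three_def)
    moreover have "x < ?f x" for x
      using x[of x] l[of "x - 3"] by (auto simp: add_three_def)
    moreover have "?f x = Suc x" if "n + 3 \<le> Suc x" for x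
      using x[of x] t[of "x - 3"] that assms by (auto simp: add_three_def)
    ultimately show "semiorder_code (n + 3) ?f"
      unfolding semiorder_code_def by (simp add: mono_iff_le_Suc)
  qed
  moreover have "graded_from ?f (?f 0) \<longleftrightarrow> graded_from g (g 0)" if "semiorder_code n g"
  proof -
    have "graded_from ?f (g 0 + 3) \<longleftrightarrow> graded_from g (g 0)"
      using that graded_from_shift[of 0 ?f 3 g "g 0"] unfolding semiorder_code_def by (simp add: f)
    moreover have "?f 3 = g 0 + 3"
      using f(4)[of 0] by simp
    ultimately show ?thesis
      by (subst graded_from_unfold) (simp add: f)
  qed
  ultimately show ?thesis
    unfolding codes_def by auto
qed

text \<open>From position 2 on the new code is \<open>g\<close> moved by one, and
  \<open>2 \<le> g 0\<close> keeps the orbit and the points just before it in that region.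
  Monotonicity past position 1 comes from \<open>g 0 < g 1\<close>.\<close>

lemma add_lower_in_codes_iff:
  assumes "0 < n" "2 \<le> g 0" "g 0 < g 1"
  shows "add_lower g \<in> codes (Suc n) \<longleftrightarrow> g \<in> codes n"
proof -
  let ?f = "add_lower g"
  have f: "?f 0 = g 0 + 1" "?f (Suc 0) = g 0 + 2" "1 \<le> y \<Longrightarrow> ?f (Suc y) = Suc (g y)" for y
    by (simp_all add: add_lower_def)
  have "semiorder_code (Suc n) ?f \<longleftrightarrow> semiorder_code n g"
  proof
    assume "semiorder_code (Suc n) ?f"
    then have m: "mono ?f" and l: "\<And>x. x < ?f x" and t: "\<And>x. n \<le> x \<Longrightarrow> ?f x = Suc x"
      unfolding semiorder_code_def by auto
    have "g x \<le> g (Suc x)" for x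
      using monoD[OF m, of "Suc x" "Suc (Suc x)"] assms by (cases "x = 0") (simp_all add: f)
    moreover have "x < g x" for x
      using l[of "Suc x"] assms by (cases "x = 0") (simp_all add: f)
    moreover have "g x = Suc x" if "n \<le> Suc x" for x
    proof (cases "x = 0")
      case True
      with t[of 1] that assms show ?thesis by (simp add: f)
    next
      case False
      with t[OF that] show ?thesis by (simp add: f)
    qed
    ultimately show "semiorder_code n g"
      unfolding semiorder_code_def by (simp add: mono_iff_le_Suc)
  next
    assume "semiorder_code n g"
    then have m: "mono g" and l: "\<And>x. x < g x" and t: "\<And>x. n \<le> Suc x \<Longrightarrow> g x = Suc x"
      unfolding semiorder_code_def by auto
    \<comment> \<open>For \<open>n = 1\<close> the tail rule would force \<open>g 0 = 1\<close>.
      Hence position 1, with value \<open>g 0 + 2\<close>, lies before the tail of the new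
      code.\<close>
    have n: "2 \<le> n"
      using t[of 0] assms by force
    have x: "x = 0 \<or> x = 1 \<or> (\<exists>y\<ge>1. x = Suc y)" for x :: nat
      by presburger
    have "?f x \<le> ?f (Suc x)" for x
      using x[of x] monoD[OF m, of "x - 1" "x"] assms by (auto simp: add_lower_def)
    moreover have "x < ?f x" for x
      using x[of x] l[of "x - 1"] assms by (auto simp: add_lower_def)
    moreover have "?f x = Suc x" if "Suc n \<le> Suc x" for x
      using x[of x] t[of "x - 1"] that n by (auto simp: add_lower_def)
    ultimately show "semiorder_code (Suc n) ?f"
      unfolding semiorder_code_def by (simp add: mono_iff_le_Suc)
  qed
  moreover have "graded_from ?f (?f 0) \<longleftrightarrow> graded_from g (g 0)" if "semiorder_code n g"
    using that graded_from_shift[of 1 ?f 1 g "g 0"] assms unfolding semiorder_code_def by (simp add: f)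
  ultimately show ?thesis
    unfolding codes_def by auto
qed

text \<open>Position \<open>g 0\<close> is duplicated: the new code takes the value
  \<open>Suc (g (g 0))\<close> there and at the next position. The condition at the first orbit
  point is the one for \<open>g\<close> with both sides raised by one, and the rest of the orbit is
  moved by one.\<close>

lemma add_upper_in_codes_iff:
  assumes "2 \<le> g 0" "g 0 < g 1"
  shows "add_upper g \<in> codes (Suc n) \<longleftrightarrow> g \<in> codes n"
proof -
  let ?f = "add_upper g"
  let ?b = "g 0"
  have f: "?f 0 = ?b" "1 \<le> y \<Longrightarrow> y \<le> ?b \<Longrightarrow> ?f y = Suc (g y)" "?b \<le> y \<Longrightarrow> ?f (Suc y) = Suc (g y)" for y
    by (simp_all add: add_upper_def)
  have graded: "graded_from ?f (?f 0) \<longleftrightarrow> graded_from g ?b" if "semiorder_code n g"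
  proof -
    have l: "x < g x" for x
      using that unfolding semiorder_code_def by auto
    have "?f (?b - 1) = Suc (g (?b - 1))"
      using assms by (intro f) auto
    moreover have "?f (Suc (g (?b - 1))) = Suc (g (g (?b - 1)))"
      using l[of "?b - 1"] by (intro f) auto
    moreover have fb: "?f ?b = Suc (g ?b)"
      using assms by (intro f) auto
    moreover have "graded_from ?f (Suc (g ?b)) \<longleftrightarrow> graded_from g (g ?b)"
      using graded_from_shift[of ?b ?f 1 g "g ?b"] l by (simp add: f)
    ultimately show ?thesis
      using graded_from_unfold[of ?f ?b] graded_from_unfold[of g ?b] by (simp add: f)
  qed
  have "semiorder_code n g" if "semiorder_code (Suc n) ?f"
  proof -
    from that have m: "mono ?f" and l: "\<And>x. x < ?f x" and t: "\<And>x. n \<le> x \<Longrightarrow> ?f x = Suc x"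
      unfolding semiorder_code_def by auto
    \<comment> \<open>The tail is strictly increasing, so the repeated value places
      \<open>?b\<close> before it.\<close>
    have "?f ?b = ?f (Suc ?b)"
      using f assms by simp
    then have b: "?b < n"
      using t[of ?b] t[of "Suc ?b"] by force
    have "g x \<le> g (Suc x)" for x
    proof (cases "?b \<le> x")
      case True
      then show ?thesis
        using monoD[OF m, of "Suc x" "Suc (Suc x)"] by (simp add: f)
    next
      case False
      then show ?thesis
        using monoD[OF m, of x "Suc x"] assms by (cases "x = 0") (simp_all add: f)
    qed
    moreover have "x < g x" for x
    proof (cases "?b \<le> x")
      case True
      then show ?thesis
        using l[of "Suc x"] by (simp add: f)
    next
      \<comment> \<open>For \<open>0 < x\<close> the bound \<open>x < ?f x\<close> gives only
        \<open>x \<le> g x\<close>; strictness comes from \<open>?b < g 1\<close> and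
        monotonicity.\<close>
      case False
      then show ?thesis
        using assms monoD[OF m, of 1 x] by (cases "x = 0") (simp_all add: f)
    qed
    moreover have "g x = Suc x" if "n \<le> Suc x" for x
      using t[OF that] b that by (simp add: f)
    ultimately show ?thesis
      unfolding semiorder_code_def by (simp add: mono_iff_le_Suc)
  qed
  \<comment> \<open>This direction uses gradedness of \<open>g\<close> at its first orbit point:
    \<open>g\<close> then repeats its value at \<open>?b\<close> and \<open>Suc ?b\<close>, so
    \<open>?b\<close> lies before the tail.\<close>
  moreover have "semiorder_code (Suc n) ?f" if "g \<in> codes n"
  proof -
    from that have m: "mono g" and l: "\<And>x. x < g x" and t: "\<And>x. n \<le> Suc x \<Longrightarrow> g x = Suc x"
      and gr: "g (g (?b - 1)) = g ?b"
      unfolding semiorder_code_def codes_def by (auto dest: graded_from_unfold[THEN iffD1])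
    have "g 1 \<le> g (?b - 1)"
      using assms by (intro monoD[OF m]) auto
    then have "g (Suc ?b) \<le> g ?b"
      using gr monoD[OF m, of "Suc ?b" "g (?b - 1)"] assms by simp
    then have b: "Suc ?b < n"
      using t[of ?b] t[of "Suc ?b"] by force
    have "?f x \<le> ?f (Suc x)" for x
      using monoD[OF m, of "x - 1" x] monoD[OF m, of x "Suc x"] assms
      by (auto simp: add_upper_def)
    moreover have "x < ?f x" for x
      using l[of x] l[of "x - 1"] assms by (auto simp: add_upper_def)
    moreover have "?f x = Suc x" if "Suc n \<le> Suc x" for x
      using t[of "x - 1"] that b by (auto simp: add_upper_def)
    ultimately show ?thesis
      unfolding semiorder_code_def by (simp add: mono_iff_le_Suc)
  qed
  ultimately show ?thesis
    using graded unfolding codes_def by auto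
qed

section \<open>Injectivity of the insertions\<close>

text \<open>Letting \<open>a\<close> depend on \<open>g\<close> covers both kinds of
  prepending.\<close>

lemma inj_prepend_code: "inj (\<lambda>g. prepend_code (a g) g)"
proof (rule injI)
  fix g h assume "prepend_code (a g) g = prepend_code (a h) h"
  then have "prepend_code (a g) g (Suc y) = prepend_code (a h) h (Suc y)" for y by simp
  then show "g = h" by (intro ext) (simp add: prepend_code_def)
qed

lemma inj_add_three: "inj add_three"
proof (rule injI)
  fix g h assume "add_three g = add_three h"
  then have "add_three g (y + 3) = add_three h (y + 3)" for y by simp
  then show "g = h" by (intro ext) (simp add: add_three_def)
qed

lemma inj_add_lower: "inj add_lower"
proof (rule injI, rule ext)
  fix g h x assume "add_lower g = add_lower h"
  then have "add_lower g 0 = add_lower h 0" "add_lower g (Suc x) = add_lower h (Suc x)" by simp_all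
  then show "g x = h x" by (auto simp add: add_lower_def split: if_splits)
qed

text \<open>The value at 0 reveals \<open>g 0\<close>, hence where the shift starts; every other
  \<open>g x\<close> can then be read off at \<open>x\<close> or \<open>Suc x\<close>.\<close>

lemma inj_add_upper: "inj add_upper"
proof (rule injI, rule ext)
  fix g h x assume eq: "add_upper g = add_upper h"
  then have "add_upper g 0 = add_upper h 0" "add_upper g x = add_upper h x" "add_upper g (Suc x) = add_upper h (Suc x)"
    by simp_all
  then show "g x = h x" by (auto simp add: add_upper_def split: if_splits)
qed

section \<open>Decomposition of codes by their values at 0 and 1\<close>

text \<open>Dropping position 0 undoes a prepending when \<open>f 0 = f 1\<close> or
  \<open>f 0 = 1\<close>; otherwise the code is split.\<close>

lemma codes_Suc:
  assumes "0 < n"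
  shows "codes (Suc n) = (\<lambda>g. prepend_code (g 0) g) ` codes n \<union> prepend_code 0 ` codes n \<union> split_codes (Suc n)" (is "_ = ?R")
proof
  show "?R \<subseteq> codes (Suc n)"
    using assms prepend_code_in_codes_iff by (auto simp: split_codes_def)
  show "codes (Suc n) \<subseteq> ?R"
  proof
    fix f assume f: "f \<in> codes (Suc n)"
    then have m: "mono f" and l: "\<And>x. x < f x"
      unfolding codes_def semiorder_code_def by auto
    have Suc_g: "Suc (f (Suc y) - 1) = f (Suc y)" for y
      using l[of "Suc y"] by simp
    let ?g = "\<lambda>y. f (Suc y) - 1"
    consider "f 0 = f 1" | "f 0 = 1" | "2 \<le> f 0" "f 0 < f 1"
      using l[of 0] monoD[OF m, of 0 1] by linarith
    then show "f \<in> ?R"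
    proof cases
      case 1
      then have "f = prepend_code (?g 0) ?g"
        using Suc_g by (intro ext) (auto simp: prepend_code_def split: nat.split)
      then show ?thesis
        using f prepend_code_in_codes_iff[OF assms, of "?g 0" ?g] by (auto intro: rev_image_eqI[of ?g])
    next
      case 2
      then have "f = prepend_code 0 ?g"
        using Suc_g by (intro ext) (auto simp: prepend_code_def split: nat.split)
      then show ?thesis
        using f prepend_code_in_codes_iff[OF assms, of 0 ?g] by auto
    next
      case 3
      then show ?thesis using f by (simp add: split_codes_def)
    qed
  qed
qed

text \<open>The values at 0 and 1 tell which insertion to undo. For \<open>add_three\<close> and
  \<open>add_upper\<close>, the gradedness condition at \<open>f 0\<close> makes a deleted value
  recoverable from the next position.\<close>

lemma split_codes_add_3:
  assumes "0 < n"
  shows "split_codes (n + 3) =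
    add_three ` codes n \<union> add_lower ` split_codes (n + 2) \<union> add_upper ` split_codes (n + 2)" (is "_ = ?R")
proof
  have n: "n + 3 = Suc (n + 2)" by simp
  have "add_three g \<in> split_codes (n + 3)" if "g \<in> codes n" for g
    using that add_three_in_codes_iff[OF assms, of g] by (auto simp: split_codes_def add_three_def)
  moreover have "add_lower g \<in> split_codes (n + 3)" if "g \<in> split_codes (n + 2)" for g
    using that add_lower_in_codes_iff[of "n + 2" g] unfolding n by (auto simp: split_codes_def add_lower_def)
  moreover have "add_upper g \<in> split_codes (n + 3)" if "g \<in> split_codes (n + 2)" for g
    using that add_upper_in_codes_iff[of g "n + 2"] unfolding n by (auto simp: split_codes_def add_upper_def)
  ultimately show "?R \<subseteq> split_codes (n + 3)"
    by blast
  show "split_codes (n + 3) \<subseteq> ?R"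
  proof
    fix f assume fs: "f \<in> split_codes (n + 3)"
    then have f: "f \<in> codes (n + 3)" and f0: "2 \<le> f 0" "f 0 < f 1"
      by (auto simp: split_codes_def)
    then have m: "mono f" and l: "\<And>x. x < f x" and gr: "f (f (f 0 - 1)) = f (f 0)"
      unfolding codes_def semiorder_code_def by (auto dest: graded_from_unfold[THEN iffD1])
    consider "f 0 = 2" "f 1 = 3" | "3 \<le> f 0" "f 1 = f 0 + 1" | "f 0 + 2 \<le> f 1"
      using f0 by linarith
    then show "f \<in> ?R"
    proof cases
      case 1
      \<comment> \<open>Positions 0, 1, 2 are deleted; that \<open>f 2\<close> equals
        \<open>f 3\<close> is the condition at the orbit point 2.\<close>
      let ?g = "\<lambda>y. f (y + 3) - 3"
      have "f x = add_three ?g x" for x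
      proof (cases "x < 3")
        case True
        then have "x = 0 \<or> x = 1 \<or> x = 2" by linarith
        moreover have "f 3 = f 2" "3 \<le> f 2"
          using 1 gr l[of 2] by (auto simp: numeral_2_eq_2)
        ultimately show ?thesis
          using 1 by (auto simp: add_three_def)
      next
        case False
        then obtain y where "x = y + 3"
          by (metis add.commute le_Suc_ex not_less)
        then show ?thesis
          using l[of x] by (simp add: add_three_def)
      qed
      then have "f = add_three ?g" by blast
      then show ?thesis
        using f add_three_in_codes_iff[OF assms, of ?g] by auto
    next
      case 2
      \<comment> \<open>Position 1 is deleted; \<open>3 \<le> f 0\<close> keeps the new value at 0
        at least 2.\<close>
      let ?g = "\<lambda>y. if y = 0 then f 0 - 1 else f (Suc y) - 1"
      have "f x = add_lower ?g x" for x
        using 2 l[of x] by (auto simp: add_lower_def)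
      then have eq: "f = add_lower ?g" by blast
      moreover have g: "2 \<le> ?g 0" "?g 0 < ?g 1"
        using 2 monoD[OF m, of 1 2] by (auto simp: numeral_2_eq_2)
      moreover have "?g \<in> codes (n + 2)"
        using add_lower_in_codes_iff[OF _ g, of "n + 2"] f eq n by simp
      ultimately show ?thesis
        by (auto simp: split_codes_def)
    next
      case 3
      \<comment> \<open>Position \<open>f 0\<close> is deleted. As \<open>f 1\<close> is at least
        \<open>f 0 + 2\<close>, gradedness makes the value there equal to the next one.\<close>
      let ?g = "\<lambda>y. if y = 0 then f 0 else if y < f 0 then f y - 1 else f (Suc y) - 1"
      have "f 1 \<le> f (f 0 - 1)"
        using f0 by (intro monoD[OF m]) auto
      then have "f (Suc (f 0)) \<le> f (f 0)"
        using gr 3 monoD[OF m, of "Suc (f 0)" "f (f 0 - 1)"] by simp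
      then have "f (Suc (f 0)) = f (f 0)"
        using monoD[OF m, of "f 0" "Suc (f 0)"] by simp
      then have "f x = add_upper ?g x" for x
        using l[of x] f0 by (cases x "f 0" rule: linorder_cases) (auto simp: add_upper_def)
      then have eq: "f = add_upper ?g" by blast
      moreover have g: "2 \<le> ?g 0" "?g 0 < ?g 1"
        using 3 f0 by auto
      moreover have "?g \<in> codes (n + 2)"
        using add_upper_in_codes_iff[OF g, of "n + 2"] f eq n by simp
      ultimately show ?thesis
        by (auto simp: split_codes_def)
    qed
  qed
qed

text \<open>For \<open>n = 1\<close> every position belongs to the tail.\<close>

lemma codes_1: "codes 1 = {Suc}"
proof
  show "codes 1 \<subseteq> {Suc}"
    by (auto simp: codes_def semiorder_code_def)
  have "mono Suc"
    by (simp add: mono_iff_le_Suc)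
  then show "{Suc} \<subseteq> codes 1"
    by (auto simp: codes_def semiorder_code_def graded_from_def)
qed

text \<open>Position 2 is in the tail, which forces the values 2, 3, 3 at 0, 1, 2. Gradedness at 2
  would require \<open>f 3 = f 2\<close>, contrary to the tail.\<close>

lemma split_codes_small:
  assumes "0 < n" "n \<le> 3"
  shows "split_codes n = {}"
proof -
  have False if "f \<in> split_codes n" for f
  proof -
    from that have l: "\<And>x. x < f x" and m: "mono f" and t: "\<And>x. n \<le> Suc x \<Longrightarrow> f x = Suc x"
      and f0: "2 \<le> f 0" "f 0 < f 1" and gr: "f (f (f 0 - 1)) = f (f 0)"
      unfolding split_codes_def codes_def semiorder_code_def
      by (auto dest: graded_from_unfold[THEN iffD1])
    have "f 2 = 3"
      using t[of 2] assms by simp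
    then have "f 0 = 2" "f 1 = 3"
      using monoD[OF m, of 1 2] f0 by linarith+
    then show False
      using gr \<open>f 2 = 3\<close> t[of 3] assms by simp
  qed
  then show ?thesis by blast
qed

section \<open>Semiorders and codes\<close>

definition code_rel :: "nat \<Rightarrow> (nat \<Rightarrow> nat) \<Rightarrow> nat rel" where
  "code_rel n f = {(x, y). x < n \<and> y < n \<and> (x = y \<or> f x \<le> y)}"

lemma semiorder_codeD:
  assumes "semiorder_code n f"
  shows "x \<le> y \<Longrightarrow> f x \<le> f y" and "x < f x" and "n \<le> Suc x \<Longrightarrow> f x = Suc x"
  using assms unfolding semiorder_code_def by (auto dest: monoD)

lemma semiorder_code_le:
  assumes "semiorder_code n f" "x < n"
  shows "f x \<le> n"
  using semiorder_codeD(1)[OF assms(1), of x "n - 1"] semiorder_codeD(3)[OF assms(1), of "n - 1"] assms(2)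
  by simp

text \<open>\<open>pred_on.chain\<close> compares by the reflexive closure, which reflexivity of
  \<open>r\<close> absorbs.\<close>

lemma poset_chain_iff:
  assumes "refl_on A r"
  shows "poset_chain A r C \<longleftrightarrow> C \<subseteq> A \<and> (\<forall>x\<in>C. \<forall>y\<in>C. (x, y) \<in> r \<or> (y, x) \<in> r)"
  using assms unfolding pred_on.chain_def refl_on_def by (auto 4 3)

lemma partial_order_on_code_rel:
  assumes "semiorder_code n f"
  shows "partial_order_on {..<n} (code_rel n f)"
proof -
  note l = semiorder_codeD(2)[OF assms]
  have "trans (code_rel n f)"
  proof (rule transI)
    fix x y z assume "(x, y) \<in> code_rel n f" "(y, z) \<in> code_rel n f"
    then show "(x, z) \<in> code_rel n f"
      using l[of y] by (auto simp: code_rel_def)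
  qed
  moreover have "antisym (code_rel n f)"
  proof (rule antisymI)
    fix x y assume "(x, y) \<in> code_rel n f" "(y, x) \<in> code_rel n f"
    then show "x = y"
      using l[of x] l[of y] by (auto simp: code_rel_def)
  qed
  ultimately show ?thesis
    unfolding partial_order_on_def preorder_on_def refl_on_def by (auto simp: code_rel_def)
qed

lemma refl_on_code_rel: "refl_on {..<n} (code_rel n f)"
  by (auto simp: refl_on_def code_rel_def)

section \<open>Codes give semiorders\<close>

text \<open>Given chains \<open>f a \<le> b\<close> and \<open>f c \<le> d\<close>, the case
  \<open>a \<le> c\<close> yields \<open>f a \<le> f c \<le> d\<close>; the other case is
  symmetric.\<close>

lemma code_rel_avoids_2_2:
  assumes f: "semiorder_code n f"
  shows "\<not> contains_chain_sum 2 2 {..<n} (code_rel n f)"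
proof
  assume "contains_chain_sum 2 2 {..<n} (code_rel n f)"
  then obtain C D where C: "poset_chain {..<n} (code_rel n f) C" "card C = 2"
    and D: "poset_chain {..<n} (code_rel n f) D" "card D = 2"
    and CD: "\<forall>x\<in>C. \<forall>y\<in>D. (x, y) \<notin> code_rel n f \<and> (y, x) \<notin> code_rel n f"
    unfolding contains_chain_sum_def by blast
  have pair: "\<exists>a b. a \<in> E \<and> b \<in> E \<and> a < n \<and> b < n \<and> f a \<le> b"
    if E: "poset_chain {..<n} (code_rel n f) E" "card E = 2" for E
  proof -
    obtain x y where "E = {x, y}" "x \<noteq> y"
      using E(2) by (auto simp: card_2_iff)
    then show ?thesis
      using E(1) unfolding poset_chain_iff[OF refl_on_code_rel] by (auto simp: code_rel_def)
  qed
  obtain a b where ab: "a \<in> C" "b \<in> C" "a < n" "b < n" "f a \<le> b"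
    using pair[OF C] by blast
  obtain c d where cd: "c \<in> D" "d \<in> D" "c < n" "d < n" "f c \<le> d"
    using pair[OF D] by blast
  show False
  proof (cases "a \<le> c")
    case True
    then have "(a, d) \<in> code_rel n f"
      using semiorder_codeD(1)[OF f True] ab cd by (simp add: code_rel_def)
    then show False using CD ab cd by blast
  next
    case False
    then have "(c, b) \<in> code_rel n f"
      using semiorder_codeD(1)[OF f, of c a] ab cd by (simp add: code_rel_def)
    then show False using CD ab cd by blast
  qed
qed

text \<open>A position \<open>d\<close> is compared with the middle \<open>b\<close> of the chain:
  \<open>d \<le> b\<close> gives \<open>f d \<le> f b \<le> c\<close>, and otherwise
  \<open>f a \<le> b < d\<close>.\<close>

lemma code_rel_avoids_3_1:
  assumes f: "semiorder_code n f"
  shows "\<not> contains_chain_sum 3 1 {..<n} (code_rel n f)"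
proof
  assume "contains_chain_sum 3 1 {..<n} (code_rel n f)"
  then obtain C D where C: "poset_chain {..<n} (code_rel n f) C" "card C = 3"
    and D: "poset_chain {..<n} (code_rel n f) D" "card D = 1"
    and CD: "\<forall>x\<in>C. \<forall>y\<in>D. (x, y) \<notin> code_rel n f \<and> (y, x) \<notin> code_rel n f"
    unfolding contains_chain_sum_def by blast
  obtain x y z where "C = {x, y, z}" "x \<noteq> y" "y \<noteq> z" "x \<noteq> z"
    using C(2) by (auto simp: card_3_iff)
  then have "\<exists>a b c. a \<in> C \<and> b \<in> C \<and> c \<in> C \<and> a < n \<and> b < n \<and> c < n \<and> f a \<le> b \<and> f b \<le> c"
  proof -
    have mem: "x < n" "y < n" "z < n"
      using C(1) \<open>C = {x, y, z}\<close> unfolding poset_chain_iff[OF refl_on_code_rel] by simp_all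
    have "(u, v) \<in> code_rel n f \<or> (v, u) \<in> code_rel n f" if "u \<in> {x, y, z}" "v \<in> {x, y, z}" for u v
      using C(1) that \<open>C = {x, y, z}\<close> unfolding poset_chain_iff[OF refl_on_code_rel] by blast
    from this[of x y] this[of y z] this[of x z]
    have "f x \<le> y \<or> f y \<le> x" "f y \<le> z \<or> f z \<le> y" "f x \<le> z \<or> f z \<le> x"
      using \<open>x \<noteq> y\<close> \<open>y \<noteq> z\<close> \<open>x \<noteq> z\<close> by (simp_all add: code_rel_def) blast+
    then show ?thesis
      using mem \<open>C = {x, y, z}\<close> by blast
  qed
  then obtain a b c where abc: "a \<in> C" "b \<in> C" "c \<in> C" "a < n" "b < n" "c < n" "f a \<le> b" "f b \<le> c"
    by blast
  obtain d where d: "d \<in> D"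
    using D(2) by (auto simp: card_1_singleton_iff)
  then have "d < n"
    using D(1) unfolding poset_chain_iff[OF refl_on_code_rel] by auto
  then have "(d, c) \<in> code_rel n f \<or> (a, d) \<in> code_rel n f"
    using semiorder_codeD(1)[OF f, of d b] abc by (auto simp: code_rel_def)
  then show False using CD abc d by blast
qed

section \<open>From the forbidden subposets to a code\<close>

text \<open>By transitivity any relation between the two chains yields one of these two; for
  instance \<open>a\<close> below \<open>c\<close> puts \<open>a\<close> below
  \<open>d\<close>.\<close>

lemma no_2_2_strictD:
  assumes po: "partial_order_on A r" and no: "\<not> contains_chain_sum 2 2 A r"
    and ab: "(a, b) \<in> r" "a \<noteq> b" and cd: "(c, d) \<in> r" "c \<noteq> d"
  shows "(a, d) \<in> r \<and> a \<noteq> d \<or> (c, b) \<in> r \<and> c \<noteq> b"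
proof (rule ccontr)
  assume neg: "\<not> ?thesis"
  have rA: "r \<subseteq> A \<times> A" and refl: "refl_on A r" and tr: "trans r" and anti: "antisym r"
    using po by (auto simp: partial_order_on_def preorder_on_def)
  have inA: "a \<in> A" "b \<in> A" "c \<in> A" "d \<in> A"
    using rA ab cd by auto
  have rf: "(x, x) \<in> r" if "x \<in> A" for x
    using refl that by (auto simp: refl_on_def)
  have inc: "(x, y) \<notin> r \<and> (y, x) \<notin> r" if "x \<in> {a, b}" "y \<in> {c, d}" for x y
    using neg that ab cd tr anti unfolding trans_def antisym_def by blast
  have "poset_chain A r {a, b}" "poset_chain A r {c, d}"
    unfolding poset_chain_iff[OF refl] using inA rf ab cd by auto
  moreover have "card {a, b} = 2" "card {c, d} = 2"
    using ab cd by auto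
  moreover have "{a, b} \<inter> {c, d} = {}"
    using inc inA rf by auto
  ultimately show False
    using no inc unfolding contains_chain_sum_def by blast
qed

text \<open>Any relation of \<open>d\<close> to the chain passes on to its bottom or its
  top.\<close>

lemma no_3_1_strictD:
  assumes po: "partial_order_on A r" and no: "\<not> contains_chain_sum 3 1 A r"
    and ab: "(a, b) \<in> r" "a \<noteq> b" and bc: "(b, c) \<in> r" "b \<noteq> c" and d: "d \<in> A"
  shows "(a, d) \<in> r \<and> a \<noteq> d \<or> (d, c) \<in> r \<and> d \<noteq> c"
proof (rule ccontr)
  assume neg: "\<not> ?thesis"
  have rA: "r \<subseteq> A \<times> A" and refl: "refl_on A r" and tr: "trans r" and anti: "antisym r"
    using po by (auto simp: partial_order_on_def preorder_on_def)
  have inA: "a \<in> A" "b \<in> A" "c \<in> A"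
    using rA ab bc by auto
  have rf: "(x, x) \<in> r" if "x \<in> A" for x
    using refl that by (auto simp: refl_on_def)
  have ac: "(a, c) \<in> r" "a \<noteq> c"
    using ab bc tr anti unfolding trans_def antisym_def by blast+
  have inc: "(x, d) \<notin> r \<and> (d, x) \<notin> r" if "x \<in> {a, b, c}" for x
    using neg that ab bc ac tr anti unfolding trans_def antisym_def by blast
  have "poset_chain A r {a, b, c}" "poset_chain A r {d}"
    unfolding poset_chain_iff[OF refl] using inA rf ab bc ac d by auto
  moreover have "card {a, b, c} = 3" "card {d} = 1"
    using ab bc ac by auto
  moreover have "{a, b, c} \<inter> {d} = {}"
    using inc d rf by auto
  ultimately show False
    using no inc unfolding contains_chain_sum_def by blast
qed

text \<open>Such an \<open>S\<close> is a final segment of \<open>{..<n}\<close>, so its cardinality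
  determines where it starts.\<close>

lemma upclosed_mem_iff:
  fixes S :: "nat set"
  assumes "S \<subseteq> {..<n}" and up: "\<And>i j. i \<in> S \<Longrightarrow> i \<le> j \<Longrightarrow> j < n \<Longrightarrow> j \<in> S"
  shows "j \<in> S \<longleftrightarrow> j < n \<and> n - card S \<le> j"
proof -
  have fin: "finite S"
    using assms(1) finite_subset by blast
  show ?thesis
  proof (cases "j \<in> S")
    case True
    then have "{j..<n} \<subseteq> S"
      using up by auto
    then have "n - j \<le> card S"
      using card_mono[OF fin, of "{j..<n}"] by simp
    then show ?thesis
      using True assms(1) by auto
  next
    case False
    show ?thesis
    proof (cases "j < n")
      case True
      have "S \<subseteq> {Suc j..<n}"
      proof
        fix i assume "i \<in> S"
        then show "i \<in> {Suc j..<n}"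
          using up[of i j] True \<open>j \<notin> S\<close> assms(1) by (cases "i \<le> j") auto
      qed
      then have "card S \<le> n - Suc j"
        using card_mono[of "{Suc j..<n}" S] by simp
      then show ?thesis
        using True \<open>j \<notin> S\<close> by auto
    qed (use False in simp)
  qed
qed

lemma sorting_bijection:
  fixes key :: "nat \<Rightarrow> nat"
  shows "\<exists>p. bij_betw p {..<n} {..<n} \<and> (\<forall>i j. i \<le> j \<longrightarrow> j < n \<longrightarrow> key (p i) \<le> key (p j))"
proof -
  define xs where "xs = sort_key key [0..<n]"
  have "distinct xs" "set xs = {..<n}" "length xs = n" "sorted (map key xs)"
    by (auto simp: xs_def)
  moreover from this have "bij_betw (nth xs) {..<n} {..<n}"
    by (intro bij_betw_nth) auto
  moreover have "key (xs ! i) \<le> key (xs ! j)" if "i \<le> j" "j < n" for i j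
    using sorted_nth_mono[of "map key xs" i j] that \<open>sorted (map key xs)\<close> \<open>length xs = n\<close> by simp
  ultimately show ?thesis
    by blast
qed

lemma semiorder_isomorphic_code_rel:
  assumes po: "partial_order_on {..<n} r" and no22: "\<not> contains_chain_sum 2 2 {..<n} r"
    and no31: "\<not> contains_chain_sum 3 1 {..<n} r"
  shows "\<exists>f. semiorder_code n f \<and> poset_isomorphic {..<n} (code_rel n f) {..<n} r"
proof -
  have rA: "r \<subseteq> {..<n} \<times> {..<n}" and refl: "refl_on {..<n} r"
    using po by (auto simp: partial_order_on_def preorder_on_def)
  define L where "L x y \<longleftrightarrow> (x, y) \<in> r \<and> x \<noteq> y" for x y
  define D where "D x = {y. L y x}" for x
  define U where "U x = {y. L x y}" for x
  \<comment> \<open>The size of the strict down-set minus that of the strict up-set, raised by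
    \<open>n\<close> to stay a natural number.\<close>
  define key where "key x = card (D x) + (n - card (U x))" for x
  have DA: "D x \<subseteq> {..<n}" and UA: "U x \<subseteq> {..<n}" for x
    using rA by (auto simp: D_def U_def L_def)
  have fin: "finite (D x)" "finite (U x)" for x
    by (rule finite_subset[OF DA finite_lessThan], rule finite_subset[OF UA finite_lessThan])
  have Ule: "card (U x) \<le> n" for x
    using card_mono[OF finite_lessThan UA[of x]] by simp
  \<comment> \<open>Two elements with incomparable down-sets, or incomparable up-sets, would be part
    of a (2+2).\<close>
  have Dcmp: "D x \<subseteq> D y \<or> D y \<subseteq> D x" and Ucmp: "U x \<subseteq> U y \<or> U y \<subseteq> U x" for x y
  proof -
    have "L a d \<or> L c b" if "L a b" "L c d" for a b c d
      using no_2_2_strictD[OF po no22, of a b c d] that unfolding L_def by simp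
    then show "D x \<subseteq> D y \<or> D y \<subseteq> D x" "U x \<subseteq> U y \<or> U y \<subseteq> U x"
      unfolding D_def U_def by blast+
  qed
  have L31: "L a d \<or> L d c" if "L a b" "L b c" "d < n" for a b c d
    using no_3_1_strictD[OF po no31, of a b c d] that unfolding L_def by simp
  text \<open>With \<open>D x \<subset> D y\<close> and \<open>U x \<subset> U y\<close>, some \<open>a < y < c\<close> would be incomparable to \<open>x\<close>.\<close>
  have nested: "D x \<subseteq> D y \<and> U y \<subseteq> U x" if "key x \<le> key y" "x < n" "y < n" for x y
  proof (rule ccontr)
    assume neg: "\<not> ?thesis"
    \<comment> \<open>If one set of an element is strictly larger against the claim, the order of
      the keys forces its other set to be larger in cardinality too.\<close>
    have "\<exists>u<n. \<exists>v<n. \<not> D u \<subseteq> D v \<and> \<not> U u \<subseteq> U v"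
    proof (cases "D x \<subseteq> D y")
      case True
      then have "U x \<subset> U y"
        using neg Ucmp by blast
      then have "card (U x) < card (U y)"
        using fin by (intro psubset_card_mono)
      then have "card (D x) < card (D y)"
        using that(1) Ule[of x] Ule[of y] unfolding key_def by linarith
      then have "\<not> D y \<subseteq> D x"
        using card_mono[OF fin(1)] leD by blast
      with \<open>U x \<subset> U y\<close> that show ?thesis by blast
    next
      case False
      then have "D y \<subset> D x"
        using Dcmp by blast
      then have "card (D y) < card (D x)"
        using fin by (intro psubset_card_mono)
      then have "card (U y) < card (U x)"
        using that(1) Ule[of x] Ule[of y] unfolding key_def by linarith
      then have "\<not> U x \<subseteq> U y"
        using card_mono[OF fin(2)] leD by blast
      with False that show ?thesis by blast
    qed
    then obtain u v a c where "v < n" "L a u" "\<not> L a v" "L u c" "\<not> L v c"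
      unfolding D_def U_def by blast
    then show False
      using L31 by blast
  qed
  obtain p where p: "bij_betw p {..<n} {..<n}"
    and sorted: "\<And>i j. i \<le> j \<Longrightarrow> j < n \<Longrightarrow> key (p i) \<le> key (p j)"
    using sorting_bijection[of n key] by blast
  have pn: "p i < n" if "i < n" for i
    using bij_betwE[OF p] that by auto
  have p_nested: "D (p i) \<subseteq> D (p j) \<and> U (p j) \<subseteq> U (p i)" if "i \<le> j" "j < n" for i j
    using that nested sorted pn by simp
  \<comment> \<open>In sorted positions the up-set of \<open>p i\<close> is a final segment;
    \<open>f i\<close> is its start, or \<open>n\<close> if nothing lies above
    \<open>p i\<close>.\<close>
  define f where "f i = (if i < n then n - card (U (p i)) else Suc i)" for i
  have L_iff: "L (p i) (p j) \<longleftrightarrow> f i \<le> j" if "i < n" "j < n" for i j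
  proof -
    let ?S = "{j. j < n \<and> L (p i) (p j)}"
    have "p ` ?S = U (p i)"
    proof
      show "U (p i) \<subseteq> p ` ?S"
      proof
        fix y assume y: "y \<in> U (p i)"
        then have "y \<in> p ` {..<n}"
          using UA bij_betw_imp_surj_on[OF p] by blast
        with y show "y \<in> p ` ?S"
          by (auto simp: U_def)
      qed
    qed (auto simp: U_def)
    moreover have "inj_on p ?S"
      using bij_betw_imp_inj_on[OF p] by (rule inj_on_subset) auto
    ultimately have "card (U (p i)) = card ?S"
      using card_image by metis
    moreover have "k \<in> ?S" if "j \<in> ?S" "j \<le> k" "k < n" for j k
      using p_nested[OF that(2,3)] that by (auto simp: D_def)
    ultimately show ?thesis
      using upclosed_mem_iff[of ?S n j] that by (simp add: f_def subset_iff)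
  qed
  have "f i \<le> f (Suc i)" for i
  proof (cases "Suc i < n")
    case True
    then have "card (U (p (Suc i))) \<le> card (U (p i))"
      using p_nested[of i "Suc i"] by (intro card_mono fin) simp
    then show ?thesis
      using True by (simp add: f_def)
  qed (auto simp: f_def)
  moreover have less: "i < f i" for i
    using L_iff[of i i] by (cases "i < n") (auto simp: L_def f_def)
  moreover have "f i = Suc i" if "n \<le> Suc i" for i
    using that less[of i] by (auto simp: f_def split: if_splits)
  ultimately have "semiorder_code n f"
    unfolding semiorder_code_def by (simp add: mono_iff_le_Suc)
  moreover have "(i, j) \<in> code_rel n f \<longleftrightarrow> (p i, p j) \<in> r" if "i < n" "j < n" for i j
  proof (cases "i = j")
    case True
    then show ?thesis
      using refl pn that by (auto simp: refl_on_def code_rel_def)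
  next
    case False
    then have "p i \<noteq> p j"
      using bij_betw_imp_inj_on[OF p] that by (auto simp: inj_on_def)
    then show ?thesis
      using False L_iff[OF that] that by (simp add: L_def code_rel_def)
  qed
  ultimately show ?thesis
    using p unfolding poset_isomorphic_def by blast
qed

section \<open>Uniqueness of the code\<close>

text \<open>An isomorphism preserves the sizes \<open>n - f x\<close> of strict up-sets, so both
  codes take the same values with the same multiplicities on \<open>{..<n}\<close>. Both lists of
  values are sorted, hence equal.\<close>

lemma code_unique:
  assumes f: "semiorder_code n f" and g: "semiorder_code n g"
    and iso: "poset_isomorphic {..<n} (code_rel n f) {..<n} (code_rel n g)"
  shows "f = g"
proof -
  obtain h where h: "bij_betw h {..<n} {..<n}"
    and h_iff: "\<And>x y. x < n \<Longrightarrow> y < n \<Longrightarrow> (x, y) \<in> code_rel n f \<longleftrightarrow> (h x, h y) \<in> code_rel n g"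
    using iso unfolding poset_isomorphic_def by auto
  have h_less: "h x < n" if "x < n" for x
    using bij_betwE[OF h] that by auto
  have h_eq: "h x = h y \<longleftrightarrow> x = y" if "x < n" "y < n" for x y
    using bij_betw_imp_inj_on[OF h] that by (auto simp: inj_on_def)
  have f_eq: "f x = g (h x)" if x: "x < n" for x
  proof -
    have less_iff: "f x \<le> y \<longleftrightarrow> g (h x) \<le> h y" if y: "y < n" for y
      using h_iff[OF x y] h_eq[OF x y] h_less[OF x] h_less[OF y] x y
        semiorder_codeD(2)[OF f, of x] semiorder_codeD(2)[OF g, of "h x"]
      by (cases "x = y") (auto simp: code_rel_def)
    have "h ` {f x..<n} = {g (h x)..<n}"
    proof
      show "h ` {f x..<n} \<subseteq> {g (h x)..<n}"
        using less_iff h_less by auto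
      show "{g (h x)..<n} \<subseteq> h ` {f x..<n}"
      proof
        fix z assume z: "z \<in> {g (h x)..<n}"
        then have "z \<in> h ` {..<n}"
          using bij_betw_imp_surj_on[OF h] by simp
        then obtain y where "y < n" "z = h y"
          by blast
        with z show "z \<in> h ` {f x..<n}"
          using less_iff by auto
      qed
    qed
    moreover have "inj_on h {f x..<n}"
      using bij_betw_imp_inj_on[OF h] by (rule inj_on_subset) auto
    ultimately have "n - f x = n - g (h x)"
      using card_image[of h "{f x..<n}"] by simp
    \<comment> \<open>Both values are at most \<open>n\<close>, so the truncated subtraction loses
      nothing.\<close>
    then show ?thesis
      using semiorder_code_le[OF f x] semiorder_code_le[OF g h_less[OF x]] by linarith
  qed
  have mset: "mset (map k [0..<n]) = image_mset k (mset_set {..<n})" for k :: "nat \<Rightarrow> nat"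
    by (simp add: lessThan_atLeast0 flip: mset_set_upto_eq_mset_upto)
  have "image_mset f (mset_set {..<n}) = image_mset (g \<circ> h) (mset_set {..<n})"
    using f_eq by (intro image_mset_cong) simp
  also have "\<dots> = image_mset g (mset_set {..<n})"
    using h by (simp add: bij_betw_def image_mset_mset_set flip: multiset.map_comp)
  finally have "mset (map f [0..<n]) = mset (map g [0..<n])"
    unfolding mset .
  moreover have "sorted (map f [0..<n])" "sorted (map g [0..<n])"
    using semiorder_codeD(1)[OF f] semiorder_codeD(1)[OF g] by (auto simp: sorted_iff_nth_mono)
  ultimately have "map f [0..<n] = map g [0..<n]"
    using properties_for_sort[of "map g [0..<n]" "map f [0..<n]"] by (simp add: sorted_sort_id)
  then have "f x = g x" for x
    using semiorder_codeD(3)[OF f, of x] semiorder_codeD(3)[OF g, of x] by (cases "x < n") auto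
  then show ?thesis by blast
qed

section \<open>Gradedness\<close>

definition level :: "(nat \<Rightarrow> nat) \<Rightarrow> nat \<Rightarrow> nat" where
  "level f z = (LEAST j. z < (f ^^ Suc j) 0)"

text \<open>The orbit of 0 continues forever along the tail; only the levels that start inside the
  poset count.\<close>

definition levels :: "nat \<Rightarrow> (nat \<Rightarrow> nat) \<Rightarrow> nat set" where
  "levels n f = {j. (f ^^ j) 0 < n}"

context
  fixes n f
  assumes code: "semiorder_code n f"
begin

abbreviation (input) bound :: "nat \<Rightarrow> nat" where
  "bound j \<equiv> (f ^^ j) 0"

lemma strict_mono_bound: "strict_mono bound"
  by (simp add: strict_mono_Suc_iff semiorder_codeD(2)[OF code])

lemma level_bounds: "bound (level f z) \<le> z" "z < bound (Suc (level f z))"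
proof -
  have "z < bound (Suc z)"
    using seq_suble[OF strict_mono_bound, of "Suc z"] by simp
  then show less: "z < bound (Suc (level f z))"
    unfolding level_def by (rule LeastI)
  show "bound (level f z) \<le> z"
  proof (cases "level f z")
    case (Suc j)
    then have "\<not> z < bound (Suc j)"
      unfolding level_def by (intro not_less_Least) simp
    with Suc show ?thesis by simp
  qed simp
qed

lemma bound_less_iff: "bound i < bound j \<longleftrightarrow> i < j"
  by (rule strict_mono_less[OF strict_mono_bound])

text \<open>Applied to a point of a level, \<open>f\<close> reaches at least the start of the next
  level. Hence levels are antichains.\<close>

lemma level_less:
  assumes "f x \<le> y"
  shows "level f x < level f y"
proof -
  have "bound (Suc (level f x)) \<le> f x"
    using semiorder_codeD(1)[OF code level_bounds(1)] by simp
  also have "\<dots> < bound (Suc (level f y))"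
    using assms level_bounds(2)[of y] by simp
  finally have "Suc (level f x) < Suc (level f y)"
    by (simp only: bound_less_iff)
  then show ?thesis by simp
qed

lemma finite_levels: "finite (levels n f)"
proof (rule finite_subset)
  show "levels n f \<subseteq> {..<n}"
    unfolding levels_def using seq_suble[OF strict_mono_bound] by (auto intro: le_less_trans)
qed simp

lemma chain_code_rel_iff:
  "poset_chain {..<n} (code_rel n f) C \<longleftrightarrow>
    C \<subseteq> {..<n} \<and> (\<forall>x\<in>C. \<forall>y\<in>C. x = y \<or> f x \<le> y \<or> f y \<le> x)"
  unfolding poset_chain_iff[OF refl_on_code_rel] by (auto simp: code_rel_def subset_iff)

text \<open>A chain thus has as many elements as levels that it meets, and gradedness becomes a
  question of which levels maximal chains meet.\<close>

lemma inj_on_level: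
  assumes "poset_chain {..<n} (code_rel n f) C"
  shows "inj_on (level f) C"
proof (rule inj_onI)
  fix x y assume xy: "x \<in> C" "y \<in> C" "level f x = level f y"
  then have "x = y \<or> f x \<le> y \<or> f y \<le> x"
    using assms unfolding chain_code_rel_iff by blast
  then show "x = y"
    using level_less[of x y] level_less[of y x] xy(3) by auto
qed

lemma level_image_subset:
  assumes "poset_chain {..<n} (code_rel n f) C"
  shows "level f ` C \<subseteq> levels n f"
  using assms level_bounds(1) unfolding chain_code_rel_iff levels_def
  by (auto intro: le_less_trans)

lemma graded_from_iff:
  "graded_from f (f 0) \<longleftrightarrow> (\<forall>j. f (f (bound (Suc j) - 1)) = f (bound (Suc j)))"
  unfolding graded_from_def by (simp add: funpow_swap1)

lemma maxchain_meets_levels: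
  assumes gr: "graded_from f (f 0)" and max: "poset_maxchain {..<n} (code_rel n f) C"
  shows "level f ` C = levels n f"
proof -
  have ch: "poset_chain {..<n} (code_rel n f) C"
    using max unfolding pred_on.maxchain_def by blast
  have "j \<in> level f ` C" if j: "bound j < n" for j
  proof (rule ccontr)
    assume miss: "j \<notin> level f ` C"
    text \<open>This element of level \<open>j\<close> is above all lower levels and, by gradedness, below all
      higher ones, so it could be added to \<open>C\<close>.\<close>
    define d where "d = (if j = 0 then 0 else f (bound j - 1))"
    have fd: "f d = bound (Suc j)"
      using gr unfolding graded_from_iff d_def by (cases j) auto
    have "bound (Suc j) \<le> n"
      using semiorder_code_le[OF code j] by simp
    then have dn: "d < n"
      using fd semiorder_codeD(2)[OF code, of d] by linarith
    have cmp: "f x \<le> d \<or> f d \<le> x" if "x \<in> C" for x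
    proof (cases "x < bound j")
      case True
      then have "0 < j" by (cases j) auto
      then show ?thesis
        using True semiorder_codeD(1)[OF code, of x "bound j - 1"] by (auto simp: d_def)
    next
      case False
      have "level f x \<noteq> j"
        using miss that by blast
      moreover have "\<not> level f x < j"
      proof
        assume "level f x < j"
        then have "bound (Suc (level f x)) \<le> bound j"
          using strict_mono_less_eq[OF strict_mono_bound] by (simp only: Suc_le_eq)
        then show False
          using False level_bounds(2)[of x] by linarith
      qed
      ultimately have "\<not> bound (level f x) < bound (Suc j)"
        using bound_less_iff by (simp only:)
      then show ?thesis
        using fd level_bounds(1)[of x] by linarith
    qed
    have "d \<notin> C"
      using cmp[of d] semiorder_codeD(2)[OF code, of d] by force
    moreover have "poset_chain {..<n} (code_rel n f) (insert d C)"
      using ch cmp dn unfolding chain_code_rel_iff by blast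
    ultimately show False
      using max unfolding pred_on.maxchain_def by blast
  qed
  then show ?thesis
    using level_image_subset[OF ch] unfolding levels_def by blast
qed

text \<open>This reference chain contains the start of every level, and any further element would be
  incomparable to the start of its own level.\<close>

lemma bounds_maxchain: "poset_maxchain {..<n} (code_rel n f) (bound ` levels n f)"
proof -
  have le: "f (bound i) \<le> bound j" if "i < j" for i j
    using that strict_mono_less_eq[OF strict_mono_bound, of "Suc i" j] by simp
  have "poset_chain {..<n} (code_rel n f) (bound ` levels n f)"
    unfolding chain_code_rel_iff
  proof (intro conjI ballI)
    fix x y assume "x \<in> bound ` levels n f" "y \<in> bound ` levels n f"
    then obtain i j where "x = bound i" "y = bound j" by blast
    then show "x = y \<or> f x \<le> y \<or> f y \<le> x"
      using le[of i j] le[of j i] by (cases i j rule: linorder_cases) auto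
  qed (auto simp: levels_def)
  moreover have "z \<in> bound ` levels n f"
    if ch: "poset_chain {..<n} (code_rel n f) S" and sub: "bound ` levels n f \<subseteq> S" and z: "z \<in> S" for S z
  proof -
    have "level f z \<in> levels n f"
      using level_image_subset[OF ch] z by blast
    moreover have "bound (level f z) = z"
    proof (rule ccontr)
      let ?b = "bound (level f z)"
      assume "?b \<noteq> z"
      then have "f ?b \<le> z \<or> f z \<le> ?b"
        using ch z sub \<open>level f z \<in> levels n f\<close> unfolding chain_code_rel_iff by blast
      then show False
        using level_bounds[of z] semiorder_codeD(2)[OF code, of z] by auto
    qed
    ultimately show ?thesis by force
  qed
  ultimately show ?thesis
    unfolding pred_on.maxchain_def by blast
qed

lemma chain_extends_to_maxchain:
  assumes "poset_chain {..<n} (code_rel n f) C"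
  shows "\<exists>M. poset_maxchain {..<n} (code_rel n f) M \<and> C \<subseteq> M"
proof -
  let ?X = "{S. poset_chain {..<n} (code_rel n f) S}"
  have "finite ?X"
    by (rule finite_subset[of _ "Pow {..<n}"]) (auto simp: chain_code_rel_iff)
  from finite_has_maximal2[OF this, of C] obtain M where M: "poset_chain {..<n} (code_rel n f) M" "C \<subseteq> M"
    and maximal: "\<forall>S\<in>?X. M \<subseteq> S \<longrightarrow> M = S"
    using assms by auto
  have "\<not> M \<subset> S" if "poset_chain {..<n} (code_rel n f) S" for S
    using maximal that by auto
  with M show ?thesis
    unfolding pred_on.maxchain_def by auto
qed

text \<open>Under the condition all maximal chains meet every level; where it fails, some maximal
  chain skips a level and is shorter than the chain of level starts.\<close>

lemma graded_code_rel_iff: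
  "graded_poset {..<n} (code_rel n f) \<longleftrightarrow> graded_from f (f 0)"
proof
  assume gr: "graded_from f (f 0)"
  have "card C = card (levels n f)" if "poset_maxchain {..<n} (code_rel n f) C" for C
  proof -
    have "poset_chain {..<n} (code_rel n f) C"
      using that unfolding pred_on.maxchain_def by blast
    then have "card (level f ` C) = card C"
      by (intro card_image inj_on_level)
    then show ?thesis
      unfolding maxchain_meets_levels[OF gr that] by (rule sym)
  qed
  then show "graded_poset {..<n} (code_rel n f)"
    unfolding graded_poset_def by metis
next
  assume gp: "graded_poset {..<n} (code_rel n f)"
  \<comment> \<open>The chain of level starts fixes the common cardinality.\<close>
  have card_max: "card C = card (levels n f)" if "poset_maxchain {..<n} (code_rel n f) C" for C
  proof -
    have "inj_on bound (levels n f)"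
      using strict_mono_bound by (rule strict_mono_imp_inj_on)
    then show ?thesis
      using gp[unfolded graded_poset_def, rule_format, OF that bounds_maxchain] card_image[of bound "levels n f"] by simp
  qed
  show "graded_from f (f 0)"
  proof (rule ccontr)
    assume "\<not> graded_from f (f 0)"
    then obtain i where bad: "f (f (bound (Suc i) - 1)) \<noteq> f (bound (Suc i))"
      unfolding graded_from_iff by blast
    define j where "j = Suc i"
    define d where "d = f (bound j - 1)"
    have pos: "0 < bound j"
      using semiorder_codeD(2)[OF code, of "bound i"] by (simp add: j_def)
    have "bound j \<le> d"
      using semiorder_codeD(2)[OF code, of "bound j - 1"] pos by (simp add: d_def)
    \<comment> \<open>Monotonicity gives the weak inequality, and the failed condition makes it
      strict.\<close>
    then have big: "bound (Suc j) < f d"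
      using semiorder_codeD(1)[OF code, of "bound j" d] bad by (simp add: d_def j_def)
    \<comment> \<open>An orbit point at \<open>n\<close> or beyond satisfies the condition
      trivially, because \<open>f (bound j - 1) = bound j\<close> there.\<close>
    have bn: "bound j < n"
    proof (rule ccontr)
      assume "\<not> bound j < n"
      then have "f (bound j - 1) = bound j"
        using semiorder_codeD(3)[OF code, of "bound j - 1"] pos by simp
      then show False
        using bad by (simp add: j_def)
    qed
    text \<open>A maximal chain that jumps over the level starting at \<open>bound j\<close>.\<close>
    define C where "C = (if d < n then {bound j - 1, f d - 1} else {bound j - 1})"
    have "poset_chain {..<n} (code_rel n f) C"
    proof -
      have fb: "f (bound j - Suc 0) = d"
        by (simp add: d_def)
      have "d \<le> f d - 1 \<and> f d - 1 < n" if "d < n"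
        using that semiorder_code_le[OF code, of d] semiorder_codeD(2)[OF code, of d] by linarith
      then show ?thesis
        using bn fb unfolding chain_code_rel_iff C_def by auto
    qed
    then obtain M where max: "poset_maxchain {..<n} (code_rel n f) M" and sub: "C \<subseteq> M"
      using chain_extends_to_maxchain by blast
    then have ch: "poset_chain {..<n} (code_rel n f) M"
      unfolding pred_on.maxchain_def by blast
    \<comment> \<open>An element of level \<open>j\<close> comparable to \<open>bound j - 1\<close>
      is at least \<open>d\<close>, which makes it incomparable to \<open>f d - 1\<close>.\<close>
    have "level f z \<noteq> j" if "z \<in> M" for z
    proof
      assume "level f z = j"
      then have z: "bound j \<le> z" "z < bound (Suc j)"
        using level_bounds[of z] by simp_all
      have "bound j - 1 \<in> M"
        using sub by (simp add: C_def split: if_splits)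
      then have "bound j - 1 = z \<or> d \<le> z \<or> f z \<le> bound j - 1"
        using ch that unfolding chain_code_rel_iff d_def by blast
      then have dz: "d \<le> z"
        using z pos semiorder_codeD(2)[OF code, of z] by linarith
      have "z < n"
        using ch that unfolding chain_code_rel_iff by blast
      then have "f d - 1 \<in> M"
        using sub dz by (simp add: C_def)
      then have "z = f d - 1 \<or> f z \<le> f d - 1 \<or> f (f d - 1) \<le> z"
        using ch that unfolding chain_code_rel_iff by blast
      then show False
        using z big semiorder_codeD(1)[OF code dz] semiorder_codeD(2)[OF code, of "f d - 1"]
        by linarith
    qed
    then have "j \<notin> level f ` M"
      by blast
    moreover have "j \<in> levels n f"
      using bn by (simp add: levels_def)
    ultimately have "level f ` M \<subset> levels n f"
      using level_image_subset[OF ch] by blast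
    then have "card (level f ` M) < card (levels n f)"
      by (intro psubset_card_mono finite_levels)
    then show False
      using card_max[OF max] card_image[OF inj_on_level[OF ch]] by simp
  qed
qed

end

section \<open>Isomorphism classes correspond to codes\<close>

text \<open>The isomorphism maps maximal chains to maximal chains of the same size; a larger chain
  in \<open>B\<close> would pull back to a larger chain in \<open>A\<close>.\<close>

lemma poset_isomorphic_graded:
  assumes iso: "poset_isomorphic A r B s" and r: "refl_on A r" and s: "refl_on B s"
    and graded: "graded_poset B s"
  shows "graded_poset A r"
proof -
  obtain h where h: "bij_betw h A B" and h_iff: "\<And>x y. x \<in> A \<Longrightarrow> y \<in> A \<Longrightarrow> (x, y) \<in> r \<longleftrightarrow> (h x, h y) \<in> s"
    using iso unfolding poset_isomorphic_def by blast
  have inj: "inj_on h A" and im: "h ` A = B"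
    using h by (auto simp: bij_betw_def)
  have chain: "poset_chain B s (h ` C) \<longleftrightarrow> poset_chain A r C" if "C \<subseteq> A" for C
  proof -
    have "h ` C \<subseteq> B"
      using that im by blast
    moreover have "(h x, h y) \<in> s \<longleftrightarrow> (x, y) \<in> r" if "x \<in> C" "y \<in> C" for x y
      using h_iff[of x y] that \<open>C \<subseteq> A\<close> by blast
    ultimately show ?thesis
      using that unfolding poset_chain_iff[OF r] poset_chain_iff[OF s] by simp
  qed
  have "poset_maxchain B s (h ` C)" if C: "poset_maxchain A r C" for C
  proof -
    have CA: "C \<subseteq> A" and ch: "poset_chain A r C"
      using C unfolding pred_on.maxchain_def pred_on.chain_def by auto
    have False if T: "poset_chain B s T" "h ` C \<subset> T" for T
    proof -
      let ?S = "{x \<in> A. h x \<in> T}"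
      have "T \<subseteq> B"
        using T by (simp add: pred_on.chain_def)
      then have "h ` ?S = T"
        using im by blast
      then have "poset_chain A r ?S"
        using chain[of ?S] T by simp
      moreover have "C \<subset> ?S"
        using CA T \<open>h ` ?S = T\<close> by blast
      ultimately show False
        using C unfolding pred_on.maxchain_def by blast
    qed
    then show ?thesis
      using chain[OF CA] ch unfolding pred_on.maxchain_def by blast
  qed
  moreover have "card (h ` C) = card C" if "poset_maxchain A r C" for C
  proof -
    have "C \<subseteq> A"
      using that by (simp add: pred_on.maxchain_def pred_on.chain_def)
    then show ?thesis
      using inj by (intro card_image) (rule inj_on_subset)
  qed
  ultimately have "card C = card D" if "poset_maxchain A r C" "poset_maxchain A r D" for C D
    using graded that unfolding graded_poset_def by metis
  then show ?thesis
    unfolding graded_poset_def by blast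
qed

lemma code_rel_in_graded_semiorders:
  assumes "f \<in> codes n"
  shows "code_rel n f \<in> graded_semiorders n"
  using assms partial_order_on_code_rel graded_code_rel_iff code_rel_avoids_2_2 code_rel_avoids_3_1
  unfolding codes_def graded_semiorders_def graded_semiorder_on_def by simp

lemma graded_semiorder_code:
  assumes "r \<in> graded_semiorders n"
  shows "\<exists>f\<in>codes n. poset_isomorphic {..<n} (code_rel n f) {..<n} r"
proof -
  have po: "partial_order_on {..<n} r" and gr: "graded_poset {..<n} r"
    and no: "\<not> contains_chain_sum 2 2 {..<n} r" "\<not> contains_chain_sum 3 1 {..<n} r"
    using assms unfolding graded_semiorders_def graded_semiorder_on_def by auto
  obtain f where f: "semiorder_code n f" and iso: "poset_isomorphic {..<n} (code_rel n f) {..<n} r"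
    using semiorder_isomorphic_code_rel[OF po no] by blast
  have "graded_poset {..<n} (code_rel n f)"
    using iso refl_on_code_rel _ gr
    by (rule poset_isomorphic_graded) (use po in \<open>simp add: partial_order_on_def preorder_on_def\<close>)
  then have "f \<in> codes n"
    using f graded_code_rel_iff[OF f] by (simp add: codes_def)
  with iso show ?thesis by blast
qed

text \<open>Sending a code to the class of its poset is injective by \<open>code_unique\<close> and
  surjective by \<open>graded_semiorder_code\<close>.\<close>

lemma num_graded_semiorders_eq_card_codes: "num_graded_semiorders n = card (codes n)"
proof -
  let ?R = "graded_semiorder_iso n"
  let ?c = "\<lambda>f. ?R `` {code_rel n f}"
  note equiv = equiv_graded_semiorder_iso[of n]
  have eq_iff: "?c f = ?R `` {r} \<longleftrightarrow> poset_isomorphic {..<n} (code_rel n f) {..<n} r"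
    if "f \<in> codes n" "r \<in> graded_semiorders n" for f r
    using eq_equiv_class_iff[OF equiv code_rel_in_graded_semiorders[OF that(1)] that(2)]
      code_rel_in_graded_semiorders[OF that(1)] that(2)
    by (simp add: graded_semiorder_iso_def)
  have "inj_on ?c (codes n)"
  proof (rule inj_onI)
    fix f g assume f: "f \<in> codes n" and g: "g \<in> codes n" and "?c f = ?c g"
    then have "poset_isomorphic {..<n} (code_rel n f) {..<n} (code_rel n g)"
      using eq_iff[OF f code_rel_in_graded_semiorders[OF g]] by simp
    then show "f = g"
      using f g by (intro code_unique[of n]) (simp_all add: codes_def)
  qed
  moreover have "?c ` codes n = graded_semiorders n // ?R"
  proof
    show "?c ` codes n \<subseteq> graded_semiorders n // ?R"
      using code_rel_in_graded_semiorders by (auto intro: quotientI)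
    show "graded_semiorders n // ?R \<subseteq> ?c ` codes n"
    proof
      fix K assume "K \<in> graded_semiorders n // ?R"
      then obtain r where r: "r \<in> graded_semiorders n" and K: "K = ?R `` {r}"
        by (auto elim: quotientE)
      obtain f where f: "f \<in> codes n" "poset_isomorphic {..<n} (code_rel n f) {..<n} r"
        using graded_semiorder_code[OF r] by blast
      then have "?c f = K"
        using eq_iff[OF f(1) r] K by simp
      with f(1) show "K \<in> ?c ` codes n" by blast
    qed
  qed
  ultimately show ?thesis
    unfolding num_graded_semiorders_def using card_image by metis
qed

text \<open>Codes are functions on all naturals, but by uniqueness they inject into the relations on
  \<open>{..<n}\<close>.\<close>

lemma finite_codes: "finite (codes n)"
proof (rule finite_imageD)
  have "code_rel n ` codes n \<subseteq> Pow ({..<n} \<times> {..<n})"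
    by (auto simp: code_rel_def)
  then show "finite (code_rel n ` codes n)"
    by (rule finite_subset) simp
  show "inj_on (code_rel n) (codes n)"
  proof (rule inj_onI)
    fix f g assume f: "f \<in> codes n" and g: "g \<in> codes n" and eq: "code_rel n f = code_rel n g"
    have "poset_isomorphic {..<n} (code_rel n f) {..<n} (code_rel n f)"
      unfolding poset_isomorphic_def by (intro exI[of _ id]) simp
    then show "f = g"
      using f g eq by (intro code_unique[of n]) (simp_all add: codes_def)
  qed
qed

section \<open>Counting\<close>

text \<open>The values at 0 and 1 separate the three kinds of codes, and both prependings are
  injective.\<close>

lemma card_codes_Suc:
  assumes "0 < n"
  shows "card (codes (Suc n)) = 2 * card (codes n) + card (split_codes (Suc n))"
proof -
  let ?A = "(\<lambda>g. prepend_code (g 0) g) ` codes n" and ?B = "prepend_code 0 ` codes n"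
  let ?S = "split_codes (Suc n)"
  have fin: "finite ?A" "finite ?B" "finite ?S"
    using finite_codes by (simp_all add: split_codes_def)
  have A: "f 0 = f 1 \<and> 2 \<le> f 0" if "f \<in> ?A" for f
    using that by (auto simp: prepend_code_def codes_def Suc_le_eq dest: semiorder_codeD(2))
  have B: "f 0 = 1" if "f \<in> ?B" for f
    using that by (auto simp: prepend_code_def)
  have S: "f 0 < f 1 \<and> 2 \<le> f 0" if "f \<in> ?S" for f
    using that by (simp add: split_codes_def)
  have "f \<notin> ?B \<and> f \<notin> ?S" if "f \<in> ?A" for f
    using A[OF that] B[of f] S[of f] by linarith
  moreover have "f \<notin> ?S" if "f \<in> ?B" for f
    using B[OF that] S[of f] by linarith
  ultimately have "?A \<inter> ?B = {}" "(?A \<union> ?B) \<inter> ?S = {}"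
    by blast+
  then have "card (codes (Suc n)) = card ?A + card ?B + card ?S"
    unfolding codes_Suc[OF assms] using fin by (simp add: card_Un_disjoint)
  also have "card ?A = card (codes n)"
    using inj_prepend_code[of "\<lambda>g. g 0"] by (intro card_image) (rule inj_on_subset, auto)
  also have "card ?B = card (codes n)"
    using inj_prepend_code[of "\<lambda>g. 0"] by (intro card_image) (rule inj_on_subset, auto)
  finally show ?thesis by simp
qed

text \<open>The values at 0 and 1 also separate the images of the three injective
  insertions.\<close>

lemma card_split_codes_add_3:
  assumes "0 < n"
  shows "card (split_codes (n + 3)) = card (codes n) + 2 * card (split_codes (n + 2))"
proof -
  let ?S = "split_codes (n + 2)"
  let ?A = "add_three ` codes n" and ?B = "add_lower ` ?S" and ?C = "add_upper ` ?S"
  have fin: "finite ?A" "finite ?B" "finite ?C"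
    using finite_codes by (simp_all add: split_codes_def)
  have A: "f 0 = 2 \<and> f 1 = 3" if "f \<in> ?A" for f
    using that by (auto simp: add_three_def)
  have B: "3 \<le> f 0 \<and> f 1 = f 0 + 1" if "f \<in> ?B" for f
    using that by (auto simp: add_lower_def split_codes_def)
  have C: "f 0 + 1 < f 1" if "f \<in> ?C" for f
    using that by (auto simp: add_upper_def split_codes_def)
  have "f \<notin> ?B \<and> f \<notin> ?C" if "f \<in> ?A" for f
    using A[OF that] B[of f] C[of f] by linarith
  moreover have "f \<notin> ?C" if "f \<in> ?B" for f
    using B[OF that] C[of f] by linarith
  ultimately have "?A \<inter> ?B = {}" "(?A \<union> ?B) \<inter> ?C = {}"
    by blast+
  then have "card (split_codes (n + 3)) = card ?A + card ?B + card ?C"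
    unfolding split_codes_add_3[OF assms] using fin by (simp add: card_Un_disjoint)
  also have "card ?A = card (codes n)"
    using inj_add_three by (intro card_image) (rule inj_on_subset, auto)
  also have "card ?B = card ?S"
    using inj_add_lower by (intro card_image) (rule inj_on_subset, auto)
  also have "card ?C = card ?S"
    using inj_add_upper by (intro card_image) (rule inj_on_subset, auto)
  finally show ?thesis by simp
qed

lemma num_graded_semiorders_0: "num_graded_semiorders 0 = 1"
proof -
  have "graded_semiorders 0 = {{}}"
    unfolding graded_semiorders_def graded_semiorder_on_def graded_poset_def contains_chain_sum_def
      pred_on.maxchain_def pred_on.chain_def
    by (auto simp: partial_order_on_def preorder_on_def)
  then show ?thesis
    unfolding num_graded_semiorders_def by (simp add: quotient_def)
qed

text \<open>Eliminating the split codes from the two counting recurrences leaves the coefficients of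
  \<open>(1 - x)(1 - 3x + x^2) = 1 - 4x + 4x^2 - x^3\<close>. Integers avoid truncated
  subtraction.\<close>

lemma num_graded_semiorders_rec:
  "int (num_graded_semiorders (n + 4)) = 4 * int (num_graded_semiorders (n + 3))
    - 4 * int (num_graded_semiorders (n + 2)) + int (num_graded_semiorders (n + 1))"
  using card_codes_Suc[of "n + 3"] card_codes_Suc[of "n + 2"] card_split_codes_add_3[of "n + 1"]
  unfolding num_graded_semiorders_eq_card_codes by (simp add: eval_nat_numeral)

text \<open>There are no split codes on two or three positions, so the count doubles twice from
  1.\<close>

lemma num_graded_semiorders_small:
  "num_graded_semiorders 1 = 1" "num_graded_semiorders 2 = 2" "num_graded_semiorders 3 = 4"
  using card_codes_Suc[of 1] card_codes_Suc[of 2] split_codes_small[of 2] split_codes_small[of 3]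
  unfolding num_graded_semiorders_eq_card_codes codes_1[unfolded One_nat_def]
  by (simp_all add: codes_1[unfolded One_nat_def] eval_nat_numeral)

theorem theorem5p5:
  shows "(Abs_fps (\<lambda>n. of_nat (num_graded_semiorders n)) :: rat fps) =
    (1 - 3 * fps_X + 2 * fps_X ^ 2 - fps_X ^ 3) / ((1 - fps_X) * (1 - 3 * fps_X + fps_X ^ 2))"
proof -
  include fps_syntax
  let ?F = "Abs_fps (\<lambda>n. of_nat (num_graded_semiorders n)) :: rat fps"
  let ?Q = "(1 - fps_X) * (1 - 3 * fps_X + fps_X ^ 2) :: rat fps"
  let ?N = "1 - 3 * fps_X + 2 * fps_X ^ 2 - fps_X ^ 3 :: rat fps"
  have Q: "?Q = 1 - fps_const 4 * fps_X + fps_const 4 * fps_X ^ 2 - fps_X ^ 3"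
    by (simp add: algebra_simps power2_eq_square power3_eq_cube flip: numeral_fps_const)
  have N: "?N = 1 - fps_const 3 * fps_X + fps_const 2 * fps_X ^ 2 - fps_X ^ 3"
    by (simp flip: numeral_fps_const)
  \<comment> \<open>Coefficients from \<open>m = 4\<close> on follow from the recurrence, the first
    four from the initial values.\<close>
  have FQ: "?F * ?Q = ?N"
  proof (rule fps_ext)
    fix m
    have FQ_m: "(?F * ?Q) $ m = ?F $ m - 4 * (if m < 1 then 0 else ?F $ (m - 1))
        + 4 * (if m < 2 then 0 else ?F $ (m - 2)) - (if m < 3 then 0 else ?F $ (m - 3))"
    proof -
      have "?F * ?Q = ?F - fps_const 4 * (fps_X * ?F) + fps_const 4 * (fps_X ^ 2 * ?F) - fps_X ^ 3 * ?F"
        unfolding Q by (simp add: algebra_simps)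
      then show ?thesis
        by (simp add: fps_X_power_mult_nth)
    qed
    have N_m: "?N $ m = (if m = 0 then 1 else 0) - 3 * (if m = 1 then 1 else 0)
        + 2 * (if m = 2 then 1 else 0) - (if m = 3 then 1 else 0)"
      unfolding N by (simp add: fps_X_power_nth)
    have rec: "of_nat (num_graded_semiorders (k + 4)) = 4 * of_nat (num_graded_semiorders (k + 3))
      - 4 * of_nat (num_graded_semiorders (k + 2)) + (of_nat (num_graded_semiorders (k + 1)) :: rat)" for k
      using arg_cong[OF num_graded_semiorders_rec[of k], of "of_int :: int \<Rightarrow> rat"] by simp
    show "(?F * ?Q) $ m = ?N $ m"
    proof (cases "m < 4")
      case True
      then have "m = 0 \<or> m = 1 \<or> m = 2 \<or> m = 3" by linarith
      then show ?thesis
        unfolding FQ_m N_m using num_graded_semiorders_0 num_graded_semiorders_small by auto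
    next
      case False
      then obtain k where "m = k + 4"
        by (metis add.commute le_Suc_ex not_less)
      then show ?thesis
        unfolding FQ_m N_m using rec[of k] by (simp add: add.commute[of 3 k])
    qed
  qed
  \<comment> \<open>The constant coefficient of \<open>?Q\<close> is 1, so \<open>?Q\<close> is
    nonzero and can be cancelled.\<close>
  have "?Q $ 0 \<noteq> 0"
    by simp
  then have "?Q \<noteq> 0"
    by (metis fps_zero_nth)
  then show ?thesis
    unfolding FQ[symmetric] by (rule nonzero_mult_div_cancel_right[symmetric])
qed

end
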